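(* Let $A_m\in\mathbf{U}_m$. The following are equivalent: (i) $A_m$ is an extreme point of $\mathbf{U}_m$; (ii) every entry $a_{ij}$ of $A_m$ with $0<a_{ij}<1$ has at least one saturated neighborhood, and its minimal saturated neighborhood $A_\alpha$ is an extreme point of $\mathbf{U}_{|\alpha|}$; (iii) every entry $a_{ij}$ of $A_m$ with $0<a_{ij}<1$ has at least one saturated neighborhood, and every saturated principal submatrix $A_\alpha$ of $A_m$ is an extreme point of $\mathbf{U}_{|\alpha|}$.
   Context: $I_m=\{1,\dots,m\}$. $\mathbf{U}_m$ is the set of real $m\times m$ matrices $A_m=(a_{ij})$ with $a_{ij}=a_{ji}\ge 0$ for all $i,j$ and $\sum_{i,j\in\alpha}a_{ij}\le|\alpha|$ for every $\alpha\subset I_m$ ($|\alpha|$ the cardinality); it is convex. For $\alpha\subset I_m$ the principal submatrix $A_\alpha=(a_{ij})_{i,j\in\alpha}$ is regarded as an $|\alpha|\times|\alpha|$ matrix. A nonempty $\alpha\subset I_m$ is saturated (for $A_m$) if $\sum_{i,j\in\alpha}a_{ij}=|\alpha|$, and $A_\alpha$ is then a saturated principal submatrix. A saturated neighborhood of the entry $a_{ij}$ is a saturated principal submatrix $A_\beta$ with $i,j\in\beta$; its radius is $|\beta|$; the minimal saturated neighborhood is the one of minimal radius (unique when it exists). *)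

theory Defs
  imports Complex_Main "Jordan_Normal_Form.DL_Submatrix"
begin

text \<open>Indices start at 0, so the index set $I_m$ is \<open>{..<m}\<close>.\<close>

definition Uset :: "nat \<Rightarrow> real mat set" where
  "Uset m = {A \<in> carrier_mat m m.
     (\<forall>i<m. \<forall>j<m. A $$ (i, j) = A $$ (j, i) \<and> 0 \<le> A $$ (i, j)) \<and>
     (\<forall>\<alpha>\<subseteq>{..<m}. (\<Sum>i\<in>\<alpha>. \<Sum>j\<in>\<alpha>. A $$ (i, j)) \<le> real (card \<alpha>))}"

text \<open>Matrices of varying dimension form no \<open>real_vector\<close> type, so \<open>extreme_point_of\<close> of
  HOL-Analysis is not applicable to them; this is the same notion spelled out: a point of \<open>S\<close> lying
  in no open segment between two distinct points of \<open>S\<close>.\<close>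

definition extreme_mat_of :: "real mat \<Rightarrow> real mat set \<Rightarrow> bool" where
  "extreme_mat_of A S \<longleftrightarrow> A \<in> S \<and>
     (\<forall>B\<in>S. \<forall>C\<in>S. \<not> (B \<noteq> C \<and> (\<exists>u::real. 0 < u \<and> u < 1 \<and> A = (1 - u) \<cdot>\<^sub>m B + u \<cdot>\<^sub>m C)))"

abbreviation principal_submatrix :: "real mat \<Rightarrow> nat set \<Rightarrow> real mat" where
  "principal_submatrix A \<alpha> \<equiv> submatrix A \<alpha> \<alpha>"

definition saturated :: "real mat \<Rightarrow> nat set \<Rightarrow> bool" where
  "saturated A \<alpha> \<longleftrightarrow> \<alpha> \<noteq> {} \<and> \<alpha> \<subseteq> {..<dim_row A} \<and>
     (\<Sum>i\<in>\<alpha>. \<Sum>j\<in>\<alpha>. A $$ (i, j)) = real (card \<alpha>)"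

text \<open>A saturated neighborhood is represented by its index set \<open>\<beta>\<close>; its radius is \<open>card \<beta>\<close>.\<close>

definition saturated_nbhd :: "real mat \<Rightarrow> nat \<Rightarrow> nat \<Rightarrow> nat set \<Rightarrow> bool" where
  "saturated_nbhd A i j \<beta> \<longleftrightarrow> saturated A \<beta> \<and> i \<in> \<beta> \<and> j \<in> \<beta>"

definition minimal_saturated_nbhd :: "real mat \<Rightarrow> nat \<Rightarrow> nat \<Rightarrow> nat set \<Rightarrow> bool" where
  "minimal_saturated_nbhd A i j \<alpha> \<longleftrightarrow> saturated_nbhd A i j \<alpha> \<and>
     (\<forall>\<beta>. saturated_nbhd A i j \<beta> \<longrightarrow> card \<alpha> \<le> card \<beta>)"

lemma saturated_Int:
  assumes A: "A \<in> Uset m" and a: "saturated A \<alpha>" and b: "saturated A \<beta>" and ne: "\<alpha> \<inter> \<beta> \<noteq> {}"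
  shows "saturated A (\<alpha> \<inter> \<beta>)"
proof -
  let ?s = "\<lambda>\<gamma>. \<Sum>i\<in>\<gamma>. \<Sum>j\<in>\<gamma>. A $$ (i, j)"
  have dim: "dim_row A = m" using A by (auto simp: Uset_def)
  have sub: "\<alpha> \<subseteq> {..<m}" "\<beta> \<subseteq> {..<m}" using a b dim by (auto simp: saturated_def)
  have fin: "finite \<alpha>" "finite \<beta>" using sub finite_subset by blast+
  have nn: "0 \<le> A $$ (i, j)" if "i < m" "j < m" for i j using A that by (auto simp: Uset_def)
  have le: "?s \<gamma> \<le> real (card \<gamma>)" if "\<gamma> \<subseteq> {..<m}" for \<gamma> using A that by (auto simp: Uset_def)
  have s_prod: "?s \<gamma> = (\<Sum>p\<in>\<gamma> \<times> \<gamma>. A $$ p)" for \<gamma>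
    by (simp add: sum.cartesian_product)
  have "?s \<alpha> + ?s \<beta> = (\<Sum>p\<in>\<alpha>\<times>\<alpha> \<union> \<beta>\<times>\<beta>. A $$ p) + (\<Sum>p\<in>\<alpha>\<times>\<alpha> \<inter> \<beta>\<times>\<beta>. A $$ p)"
    unfolding s_prod using fin by (intro sum.union_inter [symmetric]) auto
  also have "\<alpha>\<times>\<alpha> \<inter> \<beta>\<times>\<beta> = (\<alpha> \<inter> \<beta>) \<times> (\<alpha> \<inter> \<beta>)" by auto
  also have "(\<Sum>p\<in>\<alpha>\<times>\<alpha> \<union> \<beta>\<times>\<beta>. A $$ p) \<le> (\<Sum>p\<in>(\<alpha> \<union> \<beta>) \<times> (\<alpha> \<union> \<beta>). A $$ p)"
    using fin sub nn by (intro sum_mono2) auto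
  finally have "?s \<alpha> + ?s \<beta> \<le> ?s (\<alpha> \<union> \<beta>) + ?s (\<alpha> \<inter> \<beta>)" unfolding s_prod by simp
  moreover have "?s \<alpha> = card \<alpha>" "?s \<beta> = card \<beta>" using a b by (auto simp: saturated_def)
  moreover have "real (card \<alpha>) + real (card \<beta>) = real (card (\<alpha> \<union> \<beta>)) + real (card (\<alpha> \<inter> \<beta>))"
    using card_Un_Int[OF fin] by linarith
  moreover have "?s (\<alpha> \<union> \<beta>) \<le> card (\<alpha> \<union> \<beta>)" "?s (\<alpha> \<inter> \<beta>) \<le> card (\<alpha> \<inter> \<beta>)"
    using sub by (auto intro!: le)
  ultimately have "?s (\<alpha> \<inter> \<beta>) = card (\<alpha> \<inter> \<beta>)" by linarith
  then show ?thesis using ne sub dim by (auto simp: saturated_def)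
qed

lemma minimal_saturated_nbhd_unique:
  assumes A: "A \<in> Uset m" and a: "minimal_saturated_nbhd A i j \<alpha>" and b: "minimal_saturated_nbhd A i j \<beta>"
  shows "\<alpha> = \<beta>"
proof -
  have sat: "saturated A \<alpha>" "saturated A \<beta>" and ij: "i \<in> \<alpha> \<inter> \<beta>" "j \<in> \<alpha> \<inter> \<beta>"
    using a b by (auto simp: minimal_saturated_nbhd_def saturated_nbhd_def)
  have fin: "finite \<alpha>" "finite \<beta>"
    using sat unfolding saturated_def by (meson finite_lessThan finite_subset)+
  have "saturated A (\<alpha> \<inter> \<beta>)" using saturated_Int[OF A sat] ij by blast
  then have "saturated_nbhd A i j (\<alpha> \<inter> \<beta>)" using ij by (simp add: saturated_nbhd_def)
  then have "card \<alpha> \<le> card (\<alpha> \<inter> \<beta>)" "card \<beta> \<le> card (\<alpha> \<inter> \<beta>)"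
    using a b by (auto simp: minimal_saturated_nbhd_def)
  then have "\<alpha> \<inter> \<beta> = \<alpha>" "\<alpha> \<inter> \<beta> = \<beta>"
    using fin by (meson card_seteq inf_le1 inf_le2)+
  then show ?thesis by simp
qed

end

theory Submission
  imports Defs
begin

text \<open>If \<open>A = (1 - u) B + u C\<close> is a proper convex combination in \<open>Uset m\<close>, then restricting to a
  principal submatrix gives a convex combination of the same kind; hence extremality of \<open>A\<close> can be
  tested on principal submatrices covering all entries strictly between 0 and 1, as the entries 0
  and 1 are forced. Conversely, \<open>A\<close> is not extreme as soon as there is a nonzero symmetric \<open>D\<close> that
  vanishes where \<open>A\<close> does and whose sum over every saturated square is 0, because then
  \<open>A \<plusminus> t D\<close> lies in \<open>Uset m\<close> for small \<open>t\<close>. Such a \<open>D\<close> is a pair of symmetric units at an entry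
  without saturated neighborhood; another is the extension by zero of \<open>B - C\<close>, where \<open>A\<^sub>\<alpha>\<close> lies
  strictly between \<open>B\<close> and \<open>C\<close> and \<open>\<alpha>\<close> is saturated: if \<open>\<beta>\<close> is saturated then so is
  \<open>\<alpha> \<inter> \<beta>\<close>, unless empty, and a saturated sum of \<open>A\<^sub>\<alpha>\<close> is attained by both \<open>B\<close> and \<open>C\<close>.\<close>

section \<open>Bounds on entries and rigidity of convex combinations\<close>

lemma Uset_carrier: "A \<in> Uset m \<Longrightarrow> A \<in> carrier_mat m m"
  by (simp add: Uset_def)

lemma Uset_sym: "A \<in> Uset m \<Longrightarrow> i < m \<Longrightarrow> j < m \<Longrightarrow> A $$ (i, j) = A $$ (j, i)"
  by (simp add: Uset_def)

lemma Uset_nonneg: "A \<in> Uset m \<Longrightarrow> i < m \<Longrightarrow> j < m \<Longrightarrow> 0 \<le> A $$ (i, j)"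
  by (simp add: Uset_def)

lemma Uset_sum_le:
  "A \<in> Uset m \<Longrightarrow> \<alpha> \<subseteq> {..<m} \<Longrightarrow> (\<Sum>i\<in>\<alpha>. \<Sum>j\<in>\<alpha>. A $$ (i, j)) \<le> real (card \<alpha>)"
  by (simp add: Uset_def)

text \<open>The bound for the index set \<open>{i, j}\<close> suffices: off the diagonal the entry
  is counted twice by symmetry, against a cardinality of 2.\<close>

lemma Uset_le_1:
  assumes A: "A \<in> Uset m" and ij: "i < m" "j < m"
  shows "A $$ (i, j) \<le> 1"
proof (cases "i = j")
  case True
  then show ?thesis using Uset_sum_le[OF A, of "{i}"] ij by simp
next
  case False
  then show ?thesis
    using Uset_sum_le[OF A, of "{i, j}"] ij Uset_sym[OF A ij]
      Uset_nonneg[OF A, of i i] Uset_nonneg[OF A, of j j] by simp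
qed

text \<open>The gaps \<open>a - b\<close> and \<open>a - c\<close> are nonnegative and their sum
  with positive weights is zero.\<close>

lemma convex_combination_eq_upper:
  fixes a b c u :: real
  assumes "0 < u" "u < 1" "b \<le> a" "c \<le> a" "a = (1 - u) * b + u * c"
  shows "b = a" "c = a"
proof -
  have "(1 - u) * (a - b) + u * (a - c) = 0" using assms(5) by (simp add: algebra_simps)
  moreover have "0 \<le> (1 - u) * (a - b)" "0 \<le> u * (a - c)" using assms by simp_all
  ultimately have "(1 - u) * (a - b) = 0" "u * (a - c) = 0" by linarith+
  then show "b = a" "c = a" using assms by simp_all
qed

lemma convex_combination_eq_lower:
  fixes a b c u :: real
  assumes "0 < u" "u < 1" "a \<le> b" "a \<le> c" "a = (1 - u) * b + u * c"
  shows "b = a" "c = a"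
  using convex_combination_eq_upper[of u "- b" "- a" "- c"] assms by (simp_all add: algebra_simps)

section \<open>Principal submatrices and their index maps\<close>

text \<open>An index \<open>i\<close> is recovered from \<open>pick \<alpha> i\<close> as the number
  of elements of \<alpha> below it; injectivity and equal cardinality then give
  surjectivity.\<close>

lemma bij_betw_pick:
  assumes fin: "finite \<alpha>"
  shows "bij_betw (pick \<alpha>) {..<card \<alpha>} \<alpha>"
proof -
  have inj: "inj_on (pick \<alpha>) {..<card \<alpha>}"
    by (rule inj_onI) (metis card_pick_le lessThan_iff)
  have "pick \<alpha> ` {..<card \<alpha>} \<subseteq> \<alpha>" using pick_in_set_le by auto
  then have "pick \<alpha> ` {..<card \<alpha>} = \<alpha>"
    using fin inj by (intro card_subset_eq) (auto simp: card_image)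
  with inj show ?thesis by (simp add: bij_betw_def)
qed

lemma principal_submatrix_carrier:
  assumes "A \<in> carrier_mat m m" "\<alpha> \<subseteq> {..<m}"
  shows "principal_submatrix A \<alpha> \<in> carrier_mat (card \<alpha>) (card \<alpha>)"
proof -
  have "{i. i < m \<and> i \<in> \<alpha>} = \<alpha>" using assms by auto
  then show ?thesis using assms by (intro carrier_matI) (simp_all add: dim_submatrix)
qed

lemma principal_submatrix_index:
  assumes "A \<in> carrier_mat m m" "\<alpha> \<subseteq> {..<m}" "i < card \<alpha>" "j < card \<alpha>"
  shows "principal_submatrix A \<alpha> $$ (i, j) = A $$ (pick \<alpha> i, pick \<alpha> j)"
proof -
  have "{i. i < m \<and> i \<in> \<alpha>} = \<alpha>" using assms by auto
  then show ?thesis using assms by (simp add: submatrix_index)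
qed

lemma sum_principal_submatrix:
  assumes A: "A \<in> carrier_mat m m" and \<alpha>: "\<alpha> \<subseteq> {..<m}" and \<gamma>: "\<gamma> \<subseteq> {..<card \<alpha>}"
  shows "(\<Sum>i\<in>\<gamma>. \<Sum>j\<in>\<gamma>. principal_submatrix A \<alpha> $$ (i, j)) =
    (\<Sum>i\<in>pick \<alpha> ` \<gamma>. \<Sum>j\<in>pick \<alpha> ` \<gamma>. A $$ (i, j))"
proof -
  have "inj_on (pick \<alpha>) \<gamma>"
    using bij_betw_pick[of \<alpha>] \<alpha> \<gamma> finite_subset by (fastforce simp: bij_betw_def intro: inj_on_subset)
  then show ?thesis
    using \<gamma> by (auto simp: sum.reindex principal_submatrix_index[OF A \<alpha>] subset_iff intro!: sum.cong)
qed

text \<open>Under \<open>pick \<alpha>\<close> an index set of the submatrix becomes a subset of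
  \<open>{..<m}\<close> of the same cardinality, so each bound needed is one of the bounds for
  \<open>A\<close>.\<close>

lemma principal_submatrix_in_Uset:
  assumes A: "A \<in> Uset m" and \<alpha>: "\<alpha> \<subseteq> {..<m}"
  shows "principal_submatrix A \<alpha> \<in> Uset (card \<alpha>)"
proof -
  note C = Uset_carrier[OF A]
  have fin: "finite \<alpha>" using \<alpha> finite_subset by blast
  have pick: "pick \<alpha> i \<in> \<alpha>" "pick \<alpha> i < m" if "i < card \<alpha>" for i
    using that \<alpha> pick_in_set_le[of i \<alpha>] by auto
  have "(\<Sum>i\<in>\<gamma>. \<Sum>j\<in>\<gamma>. principal_submatrix A \<alpha> $$ (i, j)) \<le> real (card \<gamma>)"
    if \<gamma>: "\<gamma> \<subseteq> {..<card \<alpha>}" for \<gamma>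
  proof -
    have "card (pick \<alpha> ` \<gamma>) = card \<gamma>"
      using bij_betw_pick[OF fin] \<gamma> by (intro card_image) (auto simp: bij_betw_def intro: inj_on_subset)
    moreover have "pick \<alpha> ` \<gamma> \<subseteq> {..<m}" using \<gamma> pick by auto
    ultimately show ?thesis
      using Uset_sum_le[OF A, of "pick \<alpha> ` \<gamma>"] sum_principal_submatrix[OF C \<alpha> \<gamma>] by simp
  qed
  then show ?thesis
    using principal_submatrix_carrier[OF C \<alpha>] pick Uset_sym[OF A] Uset_nonneg[OF A]
    by (simp add: Uset_def principal_submatrix_index[OF C \<alpha>])
qed

lemma principal_submatrix_convex_combination:
  fixes B C :: "real mat"
  assumes B: "B \<in> carrier_mat m m" and C: "C \<in> carrier_mat m m" and \<alpha>: "\<alpha> \<subseteq> {..<m}"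
  shows "principal_submatrix (v \<cdot>\<^sub>m B + u \<cdot>\<^sub>m C) \<alpha> =
    v \<cdot>\<^sub>m principal_submatrix B \<alpha> + u \<cdot>\<^sub>m principal_submatrix C \<alpha>" (is "?l = ?r")
proof -
  have A: "v \<cdot>\<^sub>m B + u \<cdot>\<^sub>m C \<in> carrier_mat m m" using B C by simp
  note car = principal_submatrix_carrier[OF A \<alpha>] principal_submatrix_carrier[OF B \<alpha>]
    principal_submatrix_carrier[OF C \<alpha>]
  have "?l $$ (i, j) = ?r $$ (i, j)" if "i < card \<alpha>" "j < card \<alpha>" for i j
  proof -
    have "pick \<alpha> i < m" "pick \<alpha> j < m" using that \<alpha> pick_in_set_le by blast+
    then show ?thesis
      using that car B C
      by (simp add: principal_submatrix_index[OF A \<alpha>] principal_submatrix_index[OF B \<alpha>]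
          principal_submatrix_index[OF C \<alpha>])
  qed
  then show ?thesis using car by (intro eq_matI) auto
qed

section \<open>Small perturbations inside \<open>Uset\<close>\<close>

text \<open>A strict inequality survives a small enough step by continuity; in the case of equality
  the step is zero.\<close>

lemma eventually_perturbation_le:
  fixes a b d :: real
  assumes "a \<le> b" "a = b \<Longrightarrow> d = 0"
  shows "eventually (\<lambda>t. a + t * d \<le> b) (at_right 0)"
proof (cases "a = b")
  case True
  then show ?thesis using assms by simp
next
  case False
  have "((\<lambda>t. a + t * d) \<longlongrightarrow> a + 0 * d) (at_right 0)" by (intro tendsto_intros)
  then have "eventually (\<lambda>t. a + t * d < b) (at_right 0)"
    using False assms by (intro order_tendstoD) auto
  then show ?thesis by eventually_elim simp
qed

lemma eventually_perturbation_in_Uset: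
  fixes A D :: "real mat"
  assumes A: "A \<in> Uset m" and D: "D \<in> carrier_mat m m"
    and sym: "\<And>i j. i < m \<Longrightarrow> j < m \<Longrightarrow> D $$ (i, j) = D $$ (j, i)"
    and zero: "\<And>i j. i < m \<Longrightarrow> j < m \<Longrightarrow> A $$ (i, j) = 0 \<Longrightarrow> D $$ (i, j) = 0"
    and sat: "\<And>\<beta>. saturated A \<beta> \<Longrightarrow> (\<Sum>i\<in>\<beta>. \<Sum>j\<in>\<beta>. D $$ (i, j)) = 0"
  shows "eventually (\<lambda>t. A + t \<cdot>\<^sub>m D \<in> Uset m) (at_right 0)"
proof -
  note C = Uset_carrier[OF A]
  \<comment> \<open>Signs are reversed so that nonnegativity becomes an upper bound. There are
    finitely many constraints, so a common range of \<open>t\<close> serves all of them.\<close>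
  have "eventually (\<lambda>t. \<forall>i\<in>{..<m}. \<forall>j\<in>{..<m}. - A $$ (i, j) + t * - D $$ (i, j) \<le> 0) (at_right 0)"
    using Uset_nonneg[OF A] zero
    by (intro eventually_ball_finite ballI eventually_perturbation_le) auto
  moreover have "eventually (\<lambda>t. \<forall>\<beta>\<in>Pow {..<m}. (\<Sum>i\<in>\<beta>. \<Sum>j\<in>\<beta>. A $$ (i, j)) +
      t * (\<Sum>i\<in>\<beta>. \<Sum>j\<in>\<beta>. D $$ (i, j)) \<le> real (card \<beta>)) (at_right 0)"
  proof (intro eventually_ball_finite ballI eventually_perturbation_le)
    fix \<beta> assume "\<beta> \<in> Pow {..<m}" "(\<Sum>i\<in>\<beta>. \<Sum>j\<in>\<beta>. A $$ (i, j)) = real (card \<beta>)"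
    then show "(\<Sum>i\<in>\<beta>. \<Sum>j\<in>\<beta>. D $$ (i, j)) = 0"
      \<comment> \<open>The empty set also attains its bound, but \<open>saturated\<close> excludes
        it; its sum is trivially zero.\<close>
      using sat[of \<beta>] C by (cases "\<beta> = {}") (auto simp: saturated_def)
  qed (use Uset_sum_le[OF A] in auto)
  ultimately show ?thesis
  proof eventually_elim
    case (elim t)
    have ix: "(A + t \<cdot>\<^sub>m D) $$ (i, j) = A $$ (i, j) + t * D $$ (i, j)" if "i < m" "j < m" for i j
      using that C D by simp
    have "(\<Sum>i\<in>\<beta>. \<Sum>j\<in>\<beta>. (A + t \<cdot>\<^sub>m D) $$ (i, j)) \<le> real (card \<beta>)" if \<beta>: "\<beta> \<subseteq> {..<m}" for \<beta>
    proof -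
      have "(\<Sum>i\<in>\<beta>. \<Sum>j\<in>\<beta>. (A + t \<cdot>\<^sub>m D) $$ (i, j)) =
          (\<Sum>i\<in>\<beta>. \<Sum>j\<in>\<beta>. A $$ (i, j) + t * D $$ (i, j))"
        using \<beta> ix by (auto intro!: sum.cong)
      also have "\<dots> = (\<Sum>i\<in>\<beta>. \<Sum>j\<in>\<beta>. A $$ (i, j)) + t * (\<Sum>i\<in>\<beta>. \<Sum>j\<in>\<beta>. D $$ (i, j))"
        by (simp add: sum.distrib sum_distrib_left)
      also have "\<dots> \<le> real (card \<beta>)" using elim(2) \<beta> by blast
      finally show ?thesis .
    qed
    moreover have "0 \<le> A $$ (i, j) + t * D $$ (i, j)" if "i < m" "j < m" for i j
      using bspec[OF bspec[OF elim(1)], of i j] that by simp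
    ultimately show ?case
      using C D Uset_sym[OF A] sym unfolding Uset_def by (simp add: ix del: index_add_mat)
  qed
qed

text \<open>If \<open>D\<close> were nonzero, \<open>A\<close> would be the midpoint of two distinct
  members of \<open>Uset m\<close>.\<close>

lemma extreme_mat_of_perturbation_eq_0:
  fixes A D :: "real mat"
  assumes ext: "extreme_mat_of A (Uset m)" and D: "D \<in> carrier_mat m m"
    and sym: "\<And>i j. i < m \<Longrightarrow> j < m \<Longrightarrow> D $$ (i, j) = D $$ (j, i)"
    and zero: "\<And>i j. i < m \<Longrightarrow> j < m \<Longrightarrow> A $$ (i, j) = 0 \<Longrightarrow> D $$ (i, j) = 0"
    and sat: "\<And>\<beta>. saturated A \<beta> \<Longrightarrow> (\<Sum>i\<in>\<beta>. \<Sum>j\<in>\<beta>. D $$ (i, j)) = 0"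
  shows "D = 0\<^sub>m m m"
proof (rule ccontr)
  assume "D \<noteq> 0\<^sub>m m m"
  then obtain i j where ij: "i < m" "j < m" "D $$ (i, j) \<noteq> 0"
    using D by (metis eq_matI carrier_matD index_zero_mat)
  have A: "A \<in> Uset m" using ext by (simp add: extreme_mat_of_def)
  note C = Uset_carrier[OF A]
  \<comment> \<open>The conditions on \<open>D\<close> are invariant under a change of sign, so
    small steps are possible in both directions.\<close>
  have neg: "(\<Sum>i\<in>\<beta>. \<Sum>j\<in>\<beta>. (- D) $$ (i, j)) = 0" if "saturated A \<beta>" for \<beta>
  proof -
    have "(\<Sum>i\<in>\<beta>. \<Sum>j\<in>\<beta>. (- D) $$ (i, j)) = (\<Sum>i\<in>\<beta>. \<Sum>j\<in>\<beta>. - D $$ (i, j))"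
      using that C D by (auto simp: saturated_def subset_iff intro!: sum.cong)
    then show ?thesis using sat[OF that] by (simp add: sum_negf)
  qed
  have "eventually (\<lambda>t. A + t \<cdot>\<^sub>m D \<in> Uset m) (at_right 0)"
    using A D sym zero sat by (rule eventually_perturbation_in_Uset)
  moreover have "eventually (\<lambda>t. A + t \<cdot>\<^sub>m (- D) \<in> Uset m) (at_right 0)"
    using D sym zero by (intro eventually_perturbation_in_Uset A neg) auto
  moreover have "eventually (\<lambda>t::real. 0 < t) (at_right 0)" by (rule eventually_at_right_less)
  ultimately have "eventually (\<lambda>t. 0 < t \<and> A + t \<cdot>\<^sub>m D \<in> Uset m \<and> A + t \<cdot>\<^sub>m (- D) \<in> Uset m) (at_right 0)"
    by eventually_elim simp
  \<comment> \<open>The filter \<open>at_right 0\<close> is nontrivial, so a property that holds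
    eventually has a witness.\<close>
  then obtain t where t: "0 < t" "A + t \<cdot>\<^sub>m D \<in> Uset m" "A + t \<cdot>\<^sub>m (- D) \<in> Uset m"
    using eventually_happens' trivial_limit_at_right_real by blast
  have "(A + t \<cdot>\<^sub>m D) $$ (i, j) \<noteq> (A + t \<cdot>\<^sub>m (- D)) $$ (i, j)" using ij t(1) C D by simp
  then have "A + t \<cdot>\<^sub>m D \<noteq> A + t \<cdot>\<^sub>m (- D)" by metis
  moreover have "A = (1 - 1 / 2) \<cdot>\<^sub>m (A + t \<cdot>\<^sub>m D) + (1 / 2) \<cdot>\<^sub>m (A + t \<cdot>\<^sub>m (- D))"
    using C D by (intro eq_matI) (auto simp: field_simps)
  moreover have "(0::real) < 1 / 2" "(1::real) / 2 < 1" by simp_all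
  ultimately show False using ext t(2,3) unfolding extreme_mat_of_def by blast
qed

section \<open>Consequences of extremality\<close>

lemma extreme_mat_of_saturated_nbhd:
  assumes ext: "extreme_mat_of A (Uset m)" and ij: "i < m" "j < m" "0 < A $$ (i, j)"
  shows "\<exists>\<beta>. saturated_nbhd A i j \<beta>"
proof (rule ccontr)
  assume none: "\<nexists>\<beta>. saturated_nbhd A i j \<beta>"
  have A: "A \<in> Uset m" using ext by (simp add: extreme_mat_of_def)
  note C = Uset_carrier[OF A]
  \<comment> \<open>Comparing unordered pairs makes \<open>D\<close> symmetric and covers the
    diagonal case \<open>i = j\<close>, where a single unit remains.\<close>
  define D :: "real mat" where "D = mat m m (\<lambda>(k, l). if {k, l} = {i, j} then 1 else 0)"
  have "D = 0\<^sub>m m m"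
  proof (rule extreme_mat_of_perturbation_eq_0[OF ext])
    show "D \<in> carrier_mat m m" by (simp add: D_def)
    show "D $$ (k, l) = D $$ (l, k)" if "k < m" "l < m" for k l
      using that by (simp add: D_def insert_commute)
    show "D $$ (k, l) = 0" if "k < m" "l < m" "A $$ (k, l) = 0" for k l
      using that ij Uset_sym[OF A ij(1,2)] by (auto simp: D_def doubleton_eq_iff)
    show "(\<Sum>k\<in>\<beta>. \<Sum>l\<in>\<beta>. D $$ (k, l)) = 0" if \<beta>: "saturated A \<beta>" for \<beta>
    proof (intro sum.neutral ballI)
      fix k l assume kl: "k \<in> \<beta>" "l \<in> \<beta>"
      then have "k < m" "l < m" using \<beta> C by (auto simp: saturated_def)
      moreover have "{k, l} \<noteq> {i, j}"
        using none \<beta> kl by (auto simp: saturated_nbhd_def doubleton_eq_iff)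
      ultimately show "D $$ (k, l) = 0" by (simp add: D_def)
    qed
  qed
  moreover have "D $$ (i, j) = 1" using ij by (simp add: D_def)
  ultimately show False using ij by simp
qed

lemma extreme_mat_of_principal_submatrix:
  assumes ext: "extreme_mat_of A (Uset m)" and \<alpha>: "saturated A \<alpha>"
  shows "extreme_mat_of (principal_submatrix A \<alpha>) (Uset (card \<alpha>))"
  unfolding extreme_mat_of_def
proof (intro conjI ballI notI; (elim conjE exE)?)
  have A: "A \<in> Uset m" using ext by (simp add: extreme_mat_of_def)
  note CA = Uset_carrier[OF A]
  have sub: "\<alpha> \<subseteq> {..<m}" using \<alpha> CA by (auto simp: saturated_def)
  have fin: "finite \<alpha>" using sub finite_subset by blast
  show "principal_submatrix A \<alpha> \<in> Uset (card \<alpha>)" by (rule principal_submatrix_in_Uset[OF A sub])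
  fix B C :: "real mat" and u :: real
  assume B: "B \<in> Uset (card \<alpha>)" and C: "C \<in> Uset (card \<alpha>)" and neq: "B \<noteq> C" and u: "0 < u" "u < 1"
    and comb: "principal_submatrix A \<alpha> = (1 - u) \<cdot>\<^sub>m B + u \<cdot>\<^sub>m C"
  note CB = Uset_carrier[OF B] and CC = Uset_carrier[OF C]
  \<comment> \<open>\<open>q\<close> inverts \<open>pick \<alpha>\<close> and carries \<alpha> back
    to \<open>{..<card \<alpha>}\<close>; outside \<alpha> its values are arbitrary, hence the case
    distinction in \<open>D\<close> below.\<close>
  define q where "q = inv_into {..<card \<alpha>} (pick \<alpha>)"
  note bij = bij_betw_pick[OF fin]
  have pick_q: "q k < card \<alpha>" "pick \<alpha> (q k) = k" if "k \<in> \<alpha>" for k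
    using that bij inv_into_into[of k "pick \<alpha>" "{..<card \<alpha>}"]
      f_inv_into_f[of k "pick \<alpha>" "{..<card \<alpha>}"] by (auto simp: q_def bij_betw_def)
  have q_pick: "q (pick \<alpha> i) = i" if "i < card \<alpha>" for i
    using that bij by (simp add: q_def bij_betw_def)
  have inj_q: "inj_on q \<alpha>" using pick_q by (metis inj_onI)
  have entry: "A $$ (k, l) = (1 - u) * B $$ (q k, q l) + u * C $$ (q k, q l)"
    if "k \<in> \<alpha>" "l \<in> \<alpha>" for k l
    using arg_cong[OF comb, of "\<lambda>M. M $$ (q k, q l)"] that pick_q CB CC
    by (simp add: principal_submatrix_index[OF CA sub])
  define D where "D = mat m m (\<lambda>(k, l).
      if k \<in> \<alpha> \<and> l \<in> \<alpha> then B $$ (q k, q l) - C $$ (q k, q l) else 0)"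
  have "D = 0\<^sub>m m m"
  proof (rule extreme_mat_of_perturbation_eq_0[OF ext])
    show "D \<in> carrier_mat m m" by (simp add: D_def)
    show "D $$ (k, l) = D $$ (l, k)" if "k < m" "l < m" for k l
      using that pick_q Uset_sym[OF B] Uset_sym[OF C] by (simp add: D_def)
    show "D $$ (k, l) = 0" if kl: "k < m" "l < m" "A $$ (k, l) = 0" for k l
    proof (cases "k \<in> \<alpha> \<and> l \<in> \<alpha>")
      case True
      \<comment> \<open>Two nonnegative numbers whose weighted mean is zero both vanish.\<close>
      then have "B $$ (q k, q l) = 0" "C $$ (q k, q l) = 0"
        using convex_combination_eq_lower[OF u, of 0 "B $$ (q k, q l)" "C $$ (q k, q l)"]
          entry[of k l] kl pick_q Uset_nonneg[OF B] Uset_nonneg[OF C] by simp_all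
      then show ?thesis using kl by (simp add: D_def)
    qed (use kl in \<open>auto simp: D_def\<close>)
    show "(\<Sum>k\<in>\<beta>. \<Sum>l\<in>\<beta>. D $$ (k, l)) = 0" if \<beta>: "saturated A \<beta>" for \<beta>
    proof -
      let ?\<gamma> = "\<alpha> \<inter> \<beta>" and ?s = "\<lambda>M. \<Sum>k\<in>\<alpha> \<inter> \<beta>. \<Sum>l\<in>\<alpha> \<inter> \<beta>. M $$ (q k, q l)"
      have \<beta>m: "\<beta> \<subseteq> {..<m}" using \<beta> CA by (auto simp: saturated_def)
      have "(\<Sum>k\<in>\<beta>. \<Sum>l\<in>\<beta>. D $$ (k, l)) = (\<Sum>p\<in>\<beta> \<times> \<beta>. D $$ p)"
        by (simp add: sum.cartesian_product)
      \<comment> \<open>\<open>D\<close> vanishes outside the square of \<alpha>, so only the square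
        of the intersection contributes.\<close>
      also have "\<dots> = (\<Sum>p\<in>?\<gamma> \<times> ?\<gamma>. D $$ p)"
        using \<beta>m finite_subset[OF \<beta>m] by (intro sum.mono_neutral_right) (auto simp: D_def subset_iff split: if_splits)
      also have "\<dots> = (\<Sum>k\<in>?\<gamma>. \<Sum>l\<in>?\<gamma>. D $$ (k, l))" by (simp add: sum.cartesian_product)
      also have "\<dots> = (\<Sum>k\<in>?\<gamma>. \<Sum>l\<in>?\<gamma>. B $$ (q k, q l) - C $$ (q k, q l))"
        using sub by (auto simp: D_def subset_iff intro!: sum.cong)
      also have "\<dots> = ?s B - ?s C" by (simp add: sum_subtractf)
      also have "\<dots> = 0"
      proof (cases "?\<gamma> = {}")
        case False
        have le: "?s M \<le> real (card ?\<gamma>)" if M: "M \<in> Uset (card \<alpha>)" for M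
        proof -
          have inj: "inj_on q ?\<gamma>" using inj_q by (rule inj_on_subset) auto
          have "q ` ?\<gamma> \<subseteq> {..<card \<alpha>}" using pick_q by auto
          then show ?thesis
            using Uset_sum_le[OF M, of "q ` ?\<gamma>"] inj by (simp add: sum.reindex card_image)
        qed
        have "real (card ?\<gamma>) = (\<Sum>k\<in>?\<gamma>. \<Sum>l\<in>?\<gamma>. A $$ (k, l))"
          using saturated_Int[OF A \<alpha> \<beta> False] by (simp add: saturated_def)
        also have "\<dots> = (\<Sum>k\<in>?\<gamma>. \<Sum>l\<in>?\<gamma>. (1 - u) * B $$ (q k, q l) + u * C $$ (q k, q l))"
          using entry by (auto intro!: sum.cong)
        also have "\<dots> = (1 - u) * ?s B + u * ?s C" by (simp only: sum.distrib sum_distrib_left)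
        \<comment> \<open>Both sums are at most the cardinality of the intersection, and their
          weighted mean attains it, so they coincide.\<close>
        finally show ?thesis using convex_combination_eq_upper[OF u le[OF B] le[OF C]] by simp
      qed simp
      finally show ?thesis .
    qed
  qed
  then have D0: "D $$ (k, l) = 0" if "k < m" "l < m" for k l using that by simp
  have "B $$ (i, j) = C $$ (i, j)" if "i < card \<alpha>" "j < card \<alpha>" for i j
  proof -
    have "pick \<alpha> i \<in> \<alpha>" "pick \<alpha> j \<in> \<alpha>" using that pick_in_set_le by blast+
    then show ?thesis
      using D0[of "pick \<alpha> i" "pick \<alpha> j"] sub that q_pick by (auto simp: D_def subset_iff)
  qed
  then have "B = C" using CB CC by (intro eq_matI) auto
  with neq show False ..
qed

section \<open>From local to global extremality\<close>

lemma extreme_mat_of_local: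
  assumes A: "A \<in> Uset m"
    and loc: "\<And>i j. i < m \<Longrightarrow> j < m \<Longrightarrow> 0 < A $$ (i, j) \<Longrightarrow> A $$ (i, j) < 1 \<Longrightarrow>
      \<exists>\<alpha>\<subseteq>{..<m}. i \<in> \<alpha> \<and> j \<in> \<alpha> \<and> extreme_mat_of (principal_submatrix A \<alpha>) (Uset (card \<alpha>))"
  shows "extreme_mat_of A (Uset m)"
  unfolding extreme_mat_of_def
proof (intro conjI ballI notI A; elim conjE exE)
  fix B C :: "real mat" and u :: real
  assume B: "B \<in> Uset m" and C: "C \<in> Uset m" and neq: "B \<noteq> C" and u: "0 < u" "u < 1"
    and comb: "A = (1 - u) \<cdot>\<^sub>m B + u \<cdot>\<^sub>m C"
  note CB = Uset_carrier[OF B] and CC = Uset_carrier[OF C]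
  have "B $$ (i, j) = C $$ (i, j)" if ij: "i < m" "j < m" for i j
  proof -
    have entry: "A $$ (i, j) = (1 - u) * B $$ (i, j) + u * C $$ (i, j)"
      using comb CB CC ij by simp
    consider "A $$ (i, j) = 0" | "A $$ (i, j) = 1" | "0 < A $$ (i, j)" "A $$ (i, j) < 1"
      using Uset_nonneg[OF A ij] Uset_le_1[OF A ij] by linarith
    then show ?thesis
    proof cases
      \<comment> \<open>Here 0 is the least value possible for an entry, and in the next case 1 is
        the greatest; \<open>B\<close> and \<open>C\<close> must share it.\<close>
      case 1
      then show ?thesis
        using convex_combination_eq_lower[OF u _ _ entry] Uset_nonneg[OF B ij] Uset_nonneg[OF C ij]
        by simp
    next
      case 2
      then show ?thesis
        using convex_combination_eq_upper[OF u _ _ entry] Uset_le_1[OF B ij] Uset_le_1[OF C ij]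
        by simp
    next
      case 3
      then obtain \<alpha> where \<alpha>: "\<alpha> \<subseteq> {..<m}" "i \<in> \<alpha>" "j \<in> \<alpha>"
        and ext: "extreme_mat_of (principal_submatrix A \<alpha>) (Uset (card \<alpha>))"
        using loc ij by blast
      have "principal_submatrix A \<alpha> =
          (1 - u) \<cdot>\<^sub>m principal_submatrix B \<alpha> + u \<cdot>\<^sub>m principal_submatrix C \<alpha>"
        unfolding comb by (rule principal_submatrix_convex_combination[OF CB CC \<alpha>(1)])
      \<comment> \<open>Both submatrices lie in \<open>Uset (card \<alpha>)\<close>, so if they
        differed, the combination would contradict \<open>ext\<close>.\<close>
      then have eq: "principal_submatrix B \<alpha> = principal_submatrix C \<alpha>"
        using ext u principal_submatrix_in_Uset[OF B \<alpha>(1)] principal_submatrix_in_Uset[OF C \<alpha>(1)]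
        unfolding extreme_mat_of_def by blast
      have "finite \<alpha>" using \<alpha>(1) finite_subset by blast
      then obtain k l where "k < card \<alpha>" "l < card \<alpha>" "i = pick \<alpha> k" "j = pick \<alpha> l"
        using bij_betw_pick \<alpha>(2,3) unfolding bij_betw_def by (metis imageE lessThan_iff)
      then show ?thesis
        using eq principal_submatrix_index[OF CB \<alpha>(1)] principal_submatrix_index[OF CC \<alpha>(1)] by metis
    qed
  qed
  then have "B = C" using CB CC by (intro eq_matI) auto
  with neq show False ..
qed

text \<open>Radii are natural numbers, so a least one exists. This supplies the \<alpha> to which
  the universally quantified clause of \<open>P2\<close> is applied.\<close>

lemma ex_minimal_saturated_nbhd:
  "saturated_nbhd A i j \<beta> \<Longrightarrow> \<exists>\<alpha>. minimal_saturated_nbhd A i j \<alpha>"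
  using ex_has_least_nat[of "saturated_nbhd A i j" \<beta> card] by (auto simp: minimal_saturated_nbhd_def)

theorem theorem2p14:
  fixes m :: nat and A :: "real mat"
  assumes "A \<in> Uset m"
  defines "P1 \<equiv> extreme_mat_of A (Uset m)"
  defines "P2 \<equiv> \<forall>i<m. \<forall>j<m. 0 < A $$ (i, j) \<and> A $$ (i, j) < 1 \<longrightarrow>
      (\<exists>\<beta>. saturated_nbhd A i j \<beta>) \<and>
      (\<forall>\<alpha>. minimal_saturated_nbhd A i j \<alpha> \<longrightarrow>
         extreme_mat_of (principal_submatrix A \<alpha>) (Uset (card \<alpha>)))"
  defines "P3 \<equiv> (\<forall>i<m. \<forall>j<m. 0 < A $$ (i, j) \<and> A $$ (i, j) < 1 \<longrightarrow>
        (\<exists>\<beta>. saturated_nbhd A i j \<beta>)) \<and>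
      (\<forall>\<alpha>. saturated A \<alpha> \<longrightarrow>
         extreme_mat_of (principal_submatrix A \<alpha>) (Uset (card \<alpha>)))"
  shows "(P1 \<longleftrightarrow> P2) \<and> (P2 \<longleftrightarrow> P3)"
proof -
  \<comment> \<open>The implications form a cycle from \<open>P1\<close> to \<open>P3\<close> to
    \<open>P2\<close> and back; the second holds because a minimal saturated neighborhood is itself
    saturated.\<close>
  have "P3" if "P1"
    using that extreme_mat_of_saturated_nbhd extreme_mat_of_principal_submatrix
    unfolding P1_def P3_def by blast
  moreover have "P2" if "P3"
    using that unfolding P2_def P3_def minimal_saturated_nbhd_def saturated_nbhd_def by blast
  moreover have "P1" if P2: "P2"
    unfolding P1_def
  proof (rule extreme_mat_of_local[OF assms(1)])
    fix i j assume "i < m" "j < m" "0 < A $$ (i, j)" "A $$ (i, j) < 1"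
    then obtain \<alpha> where \<alpha>: "minimal_saturated_nbhd A i j \<alpha>"
      and "extreme_mat_of (principal_submatrix A \<alpha>) (Uset (card \<alpha>))"
      using P2 ex_minimal_saturated_nbhd unfolding P2_def by blast
    moreover have "\<alpha> \<subseteq> {..<m}" "i \<in> \<alpha>" "j \<in> \<alpha>"
      using \<alpha> Uset_carrier[OF assms(1)]
      by (auto simp: minimal_saturated_nbhd_def saturated_nbhd_def saturated_def)
    ultimately show "\<exists>\<alpha>\<subseteq>{..<m}. i \<in> \<alpha> \<and> j \<in> \<alpha> \<and>
        extreme_mat_of (principal_submatrix A \<alpha>) (Uset (card \<alpha>))" by blast
  qed
  ultimately show ?thesis by blast
qed

end
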